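(* Let $m,n\ge2$ be two integers and $d=\gcd(m,n)$. Then $$[\mathbb{D}_n^z]\circledcirc[\mathbb{Z}_m\oplus\mathbb{Z}_2^c]=\begin{cases}\{[\mathbb{1}],[\mathbb{Z}_d]\}&\text{if } m\text{ is odd},\\ \{[\mathbb{1}],[\mathbb{Z}_2^-],[\mathbb{Z}_d]\}&\text{if } m\text{ is even}.\end{cases}$$
   Context: $[K]$ is the conjugacy class of a subgroup $K$ in $\mathrm{O}(3)$, and the clips operation is $[H_1]\circledcirc[H_2]=\{[H_1\cap gH_2g^{-1}]:g\in\mathrm{O}(3)\}$. $(e_1,e_2,e_3)$ is the canonical basis of $\mathbb{R}^3$, $\mathbf{r}(n,\theta)$ is the rotation by angle $\theta$ about the axis directed by $n\neq0$. $\mathbb{1}=\{\mathrm{Id}\}$; $\mathbb{Z}_2^c=\{\pm\mathrm{Id}\}$; $H\oplus\mathbb{Z}_2^c=H\cup(-H)$ for $H\subset\mathrm{SO}(3)$; $\mathbb{Z}_k=\{\mathbf{r}(e_3,2j\pi/k):0\le j\le k-1\}$, with $\mathbb{Z}_1=\mathbb{1}$; $\mathbb{Z}_2^-=\{\mathrm{Id},-\mathbf{r}(e_3,\pi)\}$; $\mathbb{D}_k^z=\mathbb{Z}_k\cup(-\mathbf{r}(e_1,\pi))\mathbb{Z}_k$ for $k\ge2$. *)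

theory Defs
  imports "HOL-Analysis.Analysis"
begin

unbundle cross3_syntax

definition O3 :: "(real^3^3) set" where
  "O3 = {g. orthogonal_matrix g}"

definition conj_set :: "real^3^3 \<Rightarrow> (real^3^3) set \<Rightarrow> (real^3^3) set" where
  "conj_set g H = (\<lambda>h. g ** h ** matrix_inv g) ` H"

definition conj_class :: "(real^3^3) set \<Rightarrow> (real^3^3) set set" where
  "conj_class H = {conj_set g H | g. g \<in> O3}"

text \<open>The clips operation takes conjugacy classes as arguments.  It ranges over all representatives;
  lemma \<open>clips_conj_class\<close> below shows that the result can be computed from any fixed pair of them.\<close>

definition clips :: "(real^3^3) set set \<Rightarrow> (real^3^3) set set \<Rightarrow> (real^3^3) set set set"
    (infixl "\<circledcirc>" 70) where
  "C1 \<circledcirc> C2 = {conj_class (H1 \<inter> conj_set g H2) | H1 H2 g.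
      C1 = conj_class H1 \<and> C2 = conj_class H2 \<and> g \<in> O3}"

text \<open>Rodrigues' formula, with \<open>u\<close> the unit vector along \<open>n\<close>; the orientation is that of the
  right-hand rule.\<close>

definition rot :: "real^3 \<Rightarrow> real \<Rightarrow> real^3^3" where
  "rot n \<theta> = (let u = n /\<^sub>R norm n in
     matrix (\<lambda>x. cos \<theta> *\<^sub>R x + sin \<theta> *\<^sub>R (u \<times> x) + ((1 - cos \<theta>) * (u \<bullet> x)) *\<^sub>R u))"

abbreviation e1 :: "real^3" where "e1 \<equiv> axis 1 1"
abbreviation e3 :: "real^3" where "e3 \<equiv> axis 3 1"

definition Triv :: "(real^3^3) set" where
  "Triv = {mat 1}"

definition Zcyc :: "nat \<Rightarrow> (real^3^3) set" where
  "Zcyc k = {rot e3 (2 * real j * pi / real k) | j. j \<le> k - 1}"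

definition oplus_Z2c :: "(real^3^3) set \<Rightarrow> (real^3^3) set" where
  "oplus_Z2c H = H \<union> uminus ` H"

definition Z2minus :: "(real^3^3) set" where
  "Z2minus = {mat 1, - rot e3 pi}"

definition Dz :: "nat \<Rightarrow> (real^3^3) set" where
  "Dz k = Zcyc k \<union> (\<lambda>h. (- rot e1 pi) ** h) ` Zcyc k"

lemma O3_mat_1: "mat 1 \<in> O3"
  by (simp add: O3_def orthogonal_matrix_id)

lemma O3_mult: "g \<in> O3 \<Longrightarrow> h \<in> O3 \<Longrightarrow> g ** h \<in> O3"
  by (simp add: O3_def orthogonal_matrix_mul)

lemma matrix_inv_O3:
  assumes "g \<in> O3" shows "matrix_inv g = transpose g"
proof -
  have g: "g ** transpose g = mat 1" "transpose g ** g = mat 1"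
    using assms by (simp_all add: O3_def orthogonal_matrix_def)
  then have "g ** matrix_inv g = mat 1"
    unfolding matrix_inv_def by (rule_tac someI2[of _ "transpose g"]) auto
  then have "transpose g ** (g ** matrix_inv g) = transpose g" by simp
  then show ?thesis by (simp add: matrix_mul_assoc g)
qed

lemma O3_inv: "g \<in> O3 \<Longrightarrow> matrix_inv g \<in> O3"
  by (simp add: matrix_inv_O3) (simp add: O3_def orthogonal_matrix_transpose)

lemma conj_set_1: "conj_set (mat 1) H = H"
  by (simp add: conj_set_def matrix_inv_O3 O3_mat_1 transpose_mat)

lemma conj_set_mult: "g \<in> O3 \<Longrightarrow> h \<in> O3 \<Longrightarrow> conj_set g (conj_set h H) = conj_set (g ** h) H"
  by (simp add: conj_set_def matrix_inv_O3 O3_mult image_image matrix_transpose_mul matrix_mul_assoc)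

lemma O3_inv_mult: "g \<in> O3 \<Longrightarrow> matrix_inv g ** g = mat 1" "g \<in> O3 \<Longrightarrow> g ** matrix_inv g = mat 1"
  by (simp_all add: matrix_inv_O3) (simp_all add: O3_def orthogonal_matrix_def)

lemma conj_set_Int:
  assumes "g \<in> O3" shows "conj_set g (A \<inter> B) = conj_set g A \<inter> conj_set g B"
proof -
  have "inj (\<lambda>h. g ** h ** matrix_inv g)"
    by (rule inj_on_inverseI[where g = "\<lambda>h. matrix_inv g ** h ** g"])
       (simp add: matrix_mul_assoc O3_inv_mult[OF assms],
        simp add: matrix_mul_assoc[symmetric] O3_inv_mult[OF assms])
  then show ?thesis by (simp add: conj_set_def image_Int)
qed

lemma conj_class_conj_set:
  assumes "g \<in> O3" shows "conj_class (conj_set g H) = conj_class H"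
proof -
  have "\<exists>k\<in>O3. conj_set h H = conj_set k (conj_set g H)" if "h \<in> O3" for h
    using that assms by (intro bexI[of _ "h ** matrix_inv g"])
      (simp_all add: conj_set_mult O3_mult O3_inv matrix_mul_assoc[symmetric] O3_inv_mult)
  then show ?thesis
    unfolding conj_class_def using O3_mult[OF _ assms]
    by (auto simp: conj_set_mult assms) (metis assms conj_set_mult)
qed

lemma clips_conj_class:
  "conj_class H1 \<circledcirc> conj_class H2 = {conj_class (H1 \<inter> conj_set g H2) | g. g \<in> O3}"
proof (intro set_eqI iffI)
  fix C assume "C \<in> conj_class H1 \<circledcirc> conj_class H2"
  then have "\<exists>K1 K2 g. C = conj_class (K1 \<inter> conj_set g K2) \<and>
      (conj_class H1 = conj_class K1 \<and> conj_class H2 = conj_class K2 \<and> g \<in> O3)"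
    unfolding clips_def mem_Collect_eq .
  then obtain K1 K2 g where K: "C = conj_class (K1 \<inter> conj_set g K2)" "g \<in> O3"
    "conj_class H1 = conj_class K1" "conj_class H2 = conj_class K2"
    by (elim exE conjE) (rule that)
  have self: "H \<in> conj_class H" for H
    unfolding conj_class_def mem_Collect_eq
    by (intro exI[of _ "mat 1"] conjI O3_mat_1 conj_set_1[symmetric])
  obtain a where a: "a \<in> O3" "K1 = conj_set a H1"
    using self[of K1, folded K(3)] unfolding conj_class_def
    by (elim CollectE exE conjE) (rule that)
  obtain b where b: "b \<in> O3" "K2 = conj_set b H2"
    using self[of K2, folded K(4)] unfolding conj_class_def
    by (elim CollectE exE conjE) (rule that)
  let ?k = "matrix_inv a ** (g ** b)"
  have k: "?k \<in> O3" using a b K(2) by (simp add: O3_mult O3_inv)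
  have "conj_set a (H1 \<inter> conj_set ?k H2) = K1 \<inter> conj_set g K2"
    using a b K(2) k
    by (simp add: conj_set_Int conj_set_mult O3_mult O3_inv matrix_mul_assoc O3_inv_mult)
  then have "C = conj_class (H1 \<inter> conj_set ?k H2)"
    using K(1) conj_class_conj_set[OF a(1)] by metis
  with k show "C \<in> {conj_class (H1 \<inter> conj_set g H2) | g. g \<in> O3}" by blast
next
  fix C assume "C \<in> {conj_class (H1 \<inter> conj_set g H2) | g. g \<in> O3}"
  then obtain g where "C = conj_class (H1 \<inter> conj_set g H2)" "g \<in> O3" by blast
  then show "C \<in> conj_class H1 \<circledcirc> conj_class H2"
    unfolding clips_def mem_Collect_eq by (intro exI[of _ H1] exI[of _ H2] exI[of _ g]) simp
qed

lemma rot_apply: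
  "rot n \<theta> *v x = (let u = n /\<^sub>R norm n in
     cos \<theta> *\<^sub>R x + sin \<theta> *\<^sub>R (u \<times> x) + ((1 - cos \<theta>) * (u \<bullet> x)) *\<^sub>R u)"
proof -
  have "linear (\<lambda>x. cos \<theta> *\<^sub>R x + sin \<theta> *\<^sub>R (u \<times> x) + ((1 - cos \<theta>) * (u \<bullet> x)) *\<^sub>R u)" for u :: "real^3"
    by (rule linearI) (simp_all add: cross_add_right cross_mult_right inner_add_right algebra_simps)
  from matrix_works[OF this[unfolded linear_def scalar_mult_eq_scaleR[abs_def, symmetric]]]
  show ?thesis unfolding rot_def Let_def scalar_mult_eq_scaleR .
qed

lemma rot_e3:
  "rot e3 \<theta> = vector [vector [cos \<theta>, - sin \<theta>, 0], vector [sin \<theta>, cos \<theta>, 0], vector [0, 0, 1]]"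
  by (simp add: rot_def matrix_def vec_eq_iff forall_3 cross3_def inner_vec_def sum_3 axis_def norm_vec_def L2_set_def)

lemma rot_e1_pi:
  "rot e1 pi = vector [vector [1, 0, 0], vector [0, -1, 0], vector [0, 0, -1]]"
  by (simp add: rot_def matrix_def vec_eq_iff forall_3 cross3_def inner_vec_def sum_3 axis_def norm_vec_def L2_set_def)

end

theory Submission
  imports Defs
begin

text \<open>
  Write \<open>a = g e\<^sub>3\<close> for the axis of the conjugate \<open>g (\<int>\<^sub>m \<oplus> \<int>\<^sub>2\<^sup>c) g\<^sup>-\<^sup>1\<close>.  This conjugate
  depends only on the line spanned by \<open>a\<close>: its elements are \<open>\<plusminus>r(a, \<theta>)\<close> with \<open>m\<theta> \<in> 2\<pi>\<int>\<close>
  (\<open>conj_set_cyc\<close>).  On the other side, every element of \<open>\<D>\<^sub>n\<^sup>z\<close> fixes \<open>e\<^sub>3\<close>.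

  If \<open>a = \<plusminus>e\<^sub>3\<close>, then \<open>-r(a, \<theta>)\<close> reverses \<open>e\<^sub>3\<close> and the reflections in \<open>\<D>\<^sub>n\<^sup>z\<close> have determinant \<open>-1\<close>,
  so that only \<open>\<int>\<^sub>n \<inter> \<int>\<^sub>m = \<int>\<^sub>d\<close> is left (\<open>clip_axial\<close>; Bezout's identity for the angles).

  If \<open>a\<close> and \<open>e\<^sub>3\<close> are independent, an orthogonal matrix is determined by its determinant and its
  values at \<open>a\<close> and \<open>e\<^sub>3\<close> (\<open>O3_eqI\<close>).  A common element \<open>r(a, \<theta>)\<close> fixes both vectors and is the
  identity.  A common element \<open>-r(a, \<theta>)\<close> fixes \<open>e\<^sub>3\<close> and reverses \<open>a\<close>; its eigenvectors \<open>a\<close> and \<open>e\<^sub>3\<close>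
  are then orthogonal, and it is the reflection \<open>-r(a, \<pi>)\<close>, which forces \<open>m\<close> to be even
  (\<open>clip_oblique\<close>).  So the intersection is trivial or conjugate to \<open>\<int>\<^sub>2\<^sup>-\<close>.

  Conversely, the axis \<open>e\<^sub>3\<close> gives \<open>\<int>\<^sub>d\<close>, an axis such as \<open>(3/5, 0, 4/5)\<close> that is neither parallel nor
  orthogonal to \<open>e\<^sub>3\<close> gives the trivial group, and for even \<open>m\<close> the axis \<open>e\<^sub>1\<close> gives a conjugate of
  \<open>\<int>\<^sub>2\<^sup>-\<close> because \<open>-r(e\<^sub>1, \<pi>)\<close> belongs to \<open>\<D>\<^sub>n\<^sup>z\<close>.
\<close>

section \<open>Orthogonal matrices of size three\<close>

lemma matrix_mul_uminus:
  fixes A B :: "real^3^3"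
  shows "(- A) ** B = - (A ** B)" and "A ** (- B) = - (A ** B)"
  by (simp_all add: matrix_matrix_mult_def vec_eq_iff sum_negf)

lemma uminus_matrix_vector:
  fixes A :: "real^3^3"
  shows "(- A) *v x = - (A *v x)"
  by (simp add: matrix_vector_mult_def vec_eq_iff sum_negf)

lemma det_uminus_3:
  fixes A :: "real^3^3"
  shows "det (- A) = - det A"
  by (simp add: det_3 algebra_simps)

lemma O3_uminus: "x \<in> O3 \<Longrightarrow> - x \<in> O3"
proof -
  assume "x \<in> O3"
  moreover have "transpose (- x) = - transpose x"
    by (simp add: transpose_def vec_eq_iff)
  ultimately show ?thesis
    by (simp add: O3_def orthogonal_matrix_def matrix_mul_uminus)
qed

lemma O3_inner:
  assumes "g \<in> O3"
  shows "(g *v x) \<bullet> (g *v y) = x \<bullet> y"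
proof -
  have "orthogonal_transformation ((*v) g)"
    using assms by (simp add: orthogonal_transformation_matrix O3_def)
  then show ?thesis by (simp add: orthogonal_transformation_def)
qed

lemma O3_norm:
  assumes "g \<in> O3"
  shows "norm (g *v x) = norm x"
  using O3_inner[OF assms] by (simp add: norm_eq_sqrt_inner)

lemma O3_cross:
  assumes "g \<in> O3"
  shows "g *v (x \<times> y) = det g *\<^sub>R ((g *v x) \<times> (g *v y))"
proof -
  have "orthogonal_matrix g" using assms by (simp add: O3_def)
  then have "det g * det g = 1" and "(g *v x) \<times> (g *v y) = det g *\<^sub>R (g *v (x \<times> y))"
    using det_orthogonal_matrix[of g] cross_orthogonal_matrix[of g] by auto
  then show ?thesis by simp
qed

lemma O3_apply_inv:
  assumes "g \<in> O3"
  shows "g *v (matrix_inv g *v x) = x"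
  using O3_inv_mult(2)[OF assms] by (simp add: matrix_vector_mul_assoc)

lemma O3_sgn_det:
  assumes "g \<in> O3"
  shows "det g = 1 \<or> det g = - 1"
  using assms by (simp add: O3_def det_orthogonal_matrix)

lemma det_conj_O3:
  assumes "g \<in> O3"
  shows "det (g ** x ** matrix_inv g) = det x"
proof -
  have "det g * det (matrix_inv g) = 1"
    using O3_inv_mult(2)[OF assms] by (metis det_I det_mul)
  then show ?thesis by (simp add: det_mul algebra_simps)
qed

text \<open>The coordinates of a vector in the basis \<open>a, b, a \<times> b\<close>, by Cramer's rule.\<close>

lemma cross_basis_expansion:
  fixes a b v :: "real^3"
  defines "c \<equiv> a \<times> b"
  shows "(c \<bullet> c) *\<^sub>R v = (v \<bullet> (b \<times> c)) *\<^sub>R a + (v \<bullet> (c \<times> a)) *\<^sub>R b + (v \<bullet> c) *\<^sub>R c"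
  unfolding c_def by (simp add: cross3_simps forall_3)

text \<open>The determinant and the values at two independent vectors determine the value at their cross
  product, hence the matrix.\<close>

lemma O3_eqI:
  assumes "x \<in> O3" "y \<in> O3" "det x = det y"
    and "x *v a = y *v a" "x *v b = y *v b" "a \<times> b \<noteq> 0"
  shows "x = y"
proof -
  let ?c = "a \<times> b"
  have c: "x *v ?c = y *v ?c"
    using assms by (simp add: O3_cross)
  have "x *v v = y *v v" for v
  proof -
    have "x *v ((?c \<bullet> ?c) *\<^sub>R v) = y *v ((?c \<bullet> ?c) *\<^sub>R v)"
      unfolding cross_basis_expansion
      using assms(4,5) c by (simp add: matrix_vector_right_distrib matrix_vector_mult_scaleR)
    then show ?thesis
      using assms(6) by (simp add: matrix_vector_mult_scaleR)
  qed
  then show ?thesis by (simp add: matrix_eq)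
qed

lemma O3_moves_e3:
  assumes "norm a = 1"
  obtains g where "g \<in> O3" "g *v e3 = a"
proof -
  obtain g :: "real^3^3" where "rotation_matrix g" "g *v e3 = a"
    using rotation_matrix_exists_basis[of a 3] assms by auto
  then show ?thesis
    by (intro that) (simp_all add: O3_def rotation_matrix_def)
qed

section \<open>Rotations about an arbitrary axis\<close>

lemma rot_unit_apply:
  assumes "norm a = 1"
  shows "rot a \<theta> *v x = cos \<theta> *\<^sub>R x + sin \<theta> *\<^sub>R (a \<times> x) + ((1 - cos \<theta>) * (a \<bullet> x)) *\<^sub>R a"
  using assms by (simp add: rot_apply Let_def)

lemma rot_fixes_axis: "norm a = 1 \<Longrightarrow> rot a \<theta> *v a = a"
  by (simp add: rot_unit_apply dot_square_norm algebra_simps)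

lemma rot_uminus_axis:
  assumes "norm a = 1"
  shows "rot (- a) \<theta> = rot a (- \<theta>)"
  using assms by (simp add: matrix_eq rot_unit_apply)

text \<open>An orthogonal matrix maps cross products to cross products up to its determinant, so that it
  carries Rodrigues' formula for \<open>a\<close> to that for \<open>g a\<close> and turns the angle over if \<open>det g = -1\<close>.\<close>

lemma conj_rot:
  assumes "g \<in> O3" "norm a = 1"
  shows "g ** rot a \<theta> ** matrix_inv g = rot (g *v a) (det g * \<theta>)"
proof -
  have "(g ** rot a \<theta> ** matrix_inv g) *v v = rot (g *v a) (det g * \<theta>) *v v" for v
  proof -
    define w where "w = matrix_inv g *v v"
    have v: "v = g *v w" using assms(1) by (simp add: w_def O3_apply_inv)
    have "(g ** rot a \<theta> ** matrix_inv g) *v v = g *v (rot a \<theta> *v w)"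
      by (simp add: w_def flip: matrix_vector_mul_assoc)
    also have "\<dots> = rot (g *v a) (det g * \<theta>) *v (g *v w)"
      using O3_sgn_det[OF assms(1)]
      by (auto simp: rot_unit_apply O3_norm O3_inner assms O3_cross
          matrix_vector_right_distrib matrix_vector_mult_scaleR)
    finally show ?thesis using v by simp
  qed
  then show ?thesis by (simp add: matrix_eq)
qed

lemma rot_e3_O3: "rot e3 \<theta> \<in> O3"
  and det_rot_e3: "det (rot e3 \<theta>) = 1"
proof -
  show "det (rot e3 \<theta>) = 1"
    using sin_cos_squared_add[of \<theta>] by (simp add: rot_e3 det_3 power2_eq_square)
  show "rot e3 \<theta> \<in> O3"
    using sin_cos_squared_add[of \<theta>]
    by (simp add: O3_def orthogonal_matrix rot_e3 matrix_matrix_mult_def transpose_def mat_def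
        vec_eq_iff forall_3 sum_3 power2_eq_square algebra_simps)
qed

lemma
  assumes "norm a = 1"
  shows rot_O3: "rot a \<theta> \<in> O3" and det_rot: "det (rot a \<theta>) = 1"
proof -
  obtain g where g: "g \<in> O3" "g *v e3 = a"
    using O3_moves_e3[OF assms] .
  have "det g * (det g * \<theta>) = \<theta>"
    using O3_sgn_det[OF g(1)] by auto
  then have "rot a \<theta> = g ** rot e3 (det g * \<theta>) ** matrix_inv g"
    using conj_rot[OF g(1), of e3 "det g * \<theta>"] g(2) by (simp only: norm_axis_1)
  then show "rot a \<theta> \<in> O3" "det (rot a \<theta>) = 1"
    using g(1) by (simp_all add: O3_mult O3_inv rot_e3_O3 det_conj_O3 det_rot_e3)
qed

text \<open>For a unit vector \<open>u\<close> orthogonal to \<open>a\<close>, the image of \<open>u\<close> is \<open>cos \<theta> u + sin \<theta> (a \<times> u)\<close>, with \<open>u\<close> and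
  \<open>a \<times> u\<close> orthonormal; so it determines both \<open>cos \<theta>\<close> and \<open>sin \<theta>\<close>.\<close>

lemma rot_eq_iff:
  assumes "norm a = 1"
  shows "rot a \<theta> = rot a \<phi> \<longleftrightarrow> (\<exists>i::int. \<theta> = \<phi> + 2 * pi * i)"
proof -
  have "rot a \<theta> = rot a \<phi> \<longleftrightarrow> sin \<theta> = sin \<phi> \<and> cos \<theta> = cos \<phi>"
  proof
    assume eq: "rot a \<theta> = rot a \<phi>"
    obtain g where g: "g \<in> O3" "g *v e3 = a"
      using O3_moves_e3[OF assms] .
    define u where "u = g *v e1"
    have u: "norm u = 1" "a \<bullet> u = 0"
      using g O3_norm[OF g(1), of e1] O3_inner[OF g(1), of e3 e1]
      by (simp_all add: u_def inner_axis_axis)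
    have au: "(a \<times> u) \<bullet> (a \<times> u) = 1"
      using norm_cross_dot[of a u] u assms by (simp add: dot_square_norm)
    then have "a \<times> u \<noteq> 0" by auto
    have *: "cos \<theta> *\<^sub>R u + sin \<theta> *\<^sub>R (a \<times> u) = cos \<phi> *\<^sub>R u + sin \<phi> *\<^sub>R (a \<times> u)"
      using arg_cong[OF eq, of "\<lambda>x. x *v u"] by (simp add: rot_unit_apply assms u)
    from arg_cong[OF *, of "inner u"] arg_cong[OF *, of "inner (a \<times> u)"]
    show "sin \<theta> = sin \<phi> \<and> cos \<theta> = cos \<phi>"
      using u au \<open>a \<times> u \<noteq> 0\<close> by (simp add: inner_add_right dot_cross_self dot_square_norm)
  next
    assume "sin \<theta> = sin \<phi> \<and> cos \<theta> = cos \<phi>"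
    then show "rot a \<theta> = rot a \<phi>" by (simp add: rot_def)
  qed
  then show ?thesis by (simp only: sin_cos_eq_iff)
qed

lemma rot_0: "rot a 0 = mat 1"
  by (simp add: matrix_eq rot_apply)

section \<open>Cyclic groups with an arbitrary axis\<close>

text \<open>The angles \<open>\<theta>\<close> with \<open>k\<theta> \<in> 2\<pi>\<int>\<close>, without a choice of representatives modulo \<open>2\<pi>\<close>: this set is
  visibly stable under sign changes and under translations by \<open>2\<pi>\<close>.\<close>

definition angles :: "nat \<Rightarrow> real set" where
  "angles k = {\<theta>. \<exists>i::int. real k * \<theta> = 2 * pi * of_int i}"

definition cyc :: "real^3 \<Rightarrow> nat \<Rightarrow> (real^3^3) set" where
  "cyc a k = rot a ` angles k"

lemma angles_0: "0 \<in> angles k"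
  by (auto simp: angles_def intro: exI[of _ 0])

lemma angles_uminus: "\<theta> \<in> angles k \<Longrightarrow> - \<theta> \<in> angles k"
  unfolding angles_def by (auto simp: minus_equation_iff intro: exI[of _ "- i" for i])

lemma image_uminus_angles: "uminus ` angles k = angles k"
  using angles_uminus by (force simp: image_iff)

lemma angles_shift:
  assumes "\<theta> \<in> angles k"
  shows "\<theta> + 2 * pi * of_int j \<in> angles k"
proof -
  obtain i :: int where "real k * \<theta> = 2 * pi * of_int i"
    using assms by (auto simp: angles_def)
  then have "real k * (\<theta> + 2 * pi * of_int j) = 2 * pi * of_int (i + int k * j)"
    by (simp add: algebra_simps)
  then show ?thesis unfolding angles_def by blast
qed

text \<open>By Bezout, \<open>(gcd m n) \<theta>\<close> is an integral combination of \<open>m\<theta>\<close> and \<open>n\<theta>\<close>.  This replaces the usual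
  argument with element orders in \<open>\<int>\<^sub>m \<inter> \<int>\<^sub>n\<close>.\<close>

lemma angles_gcd: "angles m \<inter> angles n = angles (gcd m n)"
proof (intro equalityI subsetI)
  fix \<theta> assume "\<theta> \<in> angles m \<inter> angles n"
  then obtain i j :: int where ij: "real m * \<theta> = 2 * pi * of_int i" "real n * \<theta> = 2 * pi * of_int j"
    by (auto simp: angles_def)
  obtain u v :: int where "u * int m + v * int n = gcd (int m) (int n)"
    using bezout_int by blast
  then have "real (gcd m n) = of_int (u * int m + v * int n)"
    by simp
  also have "\<dots> * \<theta> = of_int u * (real m * \<theta>) + of_int v * (real n * \<theta>)"
    by (simp add: algebra_simps)
  also have "\<dots> = 2 * pi * of_int (u * i + v * j)"
    unfolding ij by (simp add: algebra_simps)
  finally show "\<theta> \<in> angles (gcd m n)"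
    unfolding angles_def by blast
next
  fix \<theta> assume "\<theta> \<in> angles (gcd m n)"
  then obtain i :: int where i: "real (gcd m n) * \<theta> = 2 * pi * of_int i"
    by (auto simp: angles_def)
  have "\<theta> \<in> angles k" if "gcd m n dvd k" for k
  proof -
    obtain q where "k = gcd m n * q" using \<open>gcd m n dvd k\<close> ..
    then have "real k * \<theta> = 2 * pi * of_int (int q * i)"
      using i by (simp add: algebra_simps)
    then show ?thesis unfolding angles_def by blast
  qed
  then show "\<theta> \<in> angles m \<inter> angles n" by simp
qed

lemma pi_in_angles_iff: "pi \<in> angles k \<longleftrightarrow> even k"
proof
  assume "pi \<in> angles k"
  then obtain i :: int where "real k = 2 * of_int i"
    by (auto simp: angles_def)
  then have "int k = 2 * i" by linarith
  then show "even k" by presburger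
next
  assume "even k"
  then obtain q where "k = 2 * q" ..
  then have "real k * pi = 2 * pi * of_int (int q)" by simp
  then show "pi \<in> angles k" unfolding angles_def by blast
qed

text \<open>Reducing the integer \<open>k\<theta> / 2\<pi>\<close> modulo \<open>k\<close> gives the representative with \<open>0 \<le> j < k\<close>.\<close>

lemma Zcyc_eq_cyc:
  assumes "k \<ge> 1"
  shows "Zcyc k = cyc e3 k"
proof (intro equalityI subsetI)
  fix x assume "x \<in> Zcyc k"
  then obtain j where x: "x = rot e3 (2 * real j * pi / real k)"
    by (auto simp: Zcyc_def)
  have "real k * (2 * real j * pi / real k) = 2 * pi * of_int (int j)"
    using assms by simp
  then have "2 * real j * pi / real k \<in> angles k"
    unfolding angles_def by blast
  then show "x \<in> cyc e3 k" by (simp add: x cyc_def)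
next
  fix x assume "x \<in> cyc e3 k"
  then obtain \<theta> and i :: int where x: "x = rot e3 \<theta>" "real k * \<theta> = 2 * pi * of_int i"
    by (auto simp: cyc_def angles_def)
  define j where "j = nat (i mod int k)"
  have j: "int j = i mod int k" "j \<le> k - 1"
    using assms by (simp_all add: j_def nat_le_iff)
  have "i = int j + int k * (i div int k)"
    using j(1) by simp
  then have "of_int i = real j + real k * of_int (i div int k)"
    by (metis of_int_add of_int_mult of_int_of_nat_eq)
  with x(2) have "\<theta> = 2 * real j * pi / real k + 2 * pi * of_int (i div int k)"
    using assms by (simp add: field_simps)
  then have "x = rot e3 (2 * real j * pi / real k)"
    unfolding x(1) by (subst rot_eq_iff) auto
  with j(2) show "x \<in> Zcyc k" by (auto simp: Zcyc_def)
qed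

lemma rot_in_cyc_iff:
  assumes "norm a = 1"
  shows "rot a \<theta> \<in> cyc a k \<longleftrightarrow> \<theta> \<in> angles k"
proof
  assume "rot a \<theta> \<in> cyc a k"
  then obtain \<phi> where "\<phi> \<in> angles k" "rot a \<theta> = rot a \<phi>"
    by (auto simp: cyc_def)
  then show "\<theta> \<in> angles k"
    using rot_eq_iff[OF assms, of \<theta> \<phi>] angles_shift[of \<phi>] by auto
qed (simp add: cyc_def)

lemma cyc_uminus:
  assumes "norm a = 1"
  shows "cyc (- a) k = cyc a k"
proof -
  have "cyc (- a) k = rot a ` uminus ` angles k"
    by (simp add: cyc_def image_image rot_uminus_axis[OF assms])
  then show ?thesis by (simp add: cyc_def image_uminus_angles)
qed

text \<open>The angle may be reversed, but the set of angles of a cyclic group is symmetric.\<close>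

lemma conj_set_cyc:
  assumes "g \<in> O3" "norm a = 1"
  shows "conj_set g (cyc a k) = cyc (g *v a) k"
proof -
  have "(\<lambda>\<theta>. det g * \<theta>) ` angles k = angles k"
    using O3_sgn_det[OF assms(1)] image_uminus_angles[of k] by auto
  moreover have "conj_set g (cyc a k) = rot (g *v a) ` (\<lambda>\<theta>. det g * \<theta>) ` angles k"
    unfolding conj_set_def cyc_def image_image conj_rot[OF assms] ..
  ultimately show ?thesis by (simp add: cyc_def)
qed

lemma conj_set_oplus_Z2c: "conj_set g (oplus_Z2c H) = oplus_Z2c (conj_set g H)"
  by (simp add: conj_set_def oplus_Z2c_def image_Un image_image matrix_mul_uminus)

lemma cyc_subset_oplus_Z2c: "cyc a k \<subseteq> oplus_Z2c (cyc a k)"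
  by (simp add: oplus_Z2c_def)

lemma mat_1_in_cyc: "mat 1 \<in> cyc a k"
  unfolding cyc_def using angles_0 by (force simp: rot_0[symmetric])

lemma conj_class_reflection:
  assumes "norm a = 1"
  shows "conj_class {mat 1, - rot a pi} = conj_class Z2minus"
proof -
  obtain g where g: "g \<in> O3" "g *v e3 = a"
    using O3_moves_e3[OF assms] .
  \<comment> \<open>A half-turn does not depend on the orientation of its axis.\<close>
  have "rot a (det g * pi) = rot a pi"
    using O3_sgn_det[OF g(1)] by (auto simp: rot_def)
  then have "conj_set g Z2minus = {mat 1, - rot a pi}"
    using g conj_rot[OF g(1), of e3 pi]
    by (simp add: conj_set_def Z2minus_def matrix_mul_uminus O3_inv_mult)
  then show ?thesis
    using conj_class_conj_set[OF g(1), of Z2minus] by simp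
qed

section \<open>Intersections with the dihedral group\<close>

lemma Dz_elements:
  assumes "n \<ge> 1"
  shows "Dz n = cyc e3 n \<union> (\<lambda>h. - rot e1 pi ** h) ` cyc e3 n"
  by (simp add: Dz_def Zcyc_eq_cyc[OF assms])

lemma Dz_subset_O3:
  assumes "n \<ge> 1"
  shows "Dz n \<subseteq> O3"
  unfolding Dz_elements[OF assms] cyc_def
  by (auto intro!: O3_mult O3_uminus rot_O3)

lemma Dz_fixes_e3:
  assumes "n \<ge> 1" "x \<in> Dz n"
  shows "x *v e3 = e3"
proof -
  have "(- rot e1 pi) *v e3 = e3"
    by (simp add: uminus_matrix_vector rot_unit_apply inner_axis_axis)
  moreover have "h *v e3 = e3" if "h \<in> cyc e3 n" for h
    using that by (auto simp: cyc_def rot_fixes_axis)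
  ultimately show ?thesis
    using assms(2) unfolding Dz_elements[OF assms(1)]
    by (auto simp flip: matrix_vector_mul_assoc)
qed

lemma Dz_det_1:
  assumes "n \<ge> 1" "x \<in> Dz n" "det x = 1"
  shows "x \<in> cyc e3 n"
proof -
  have "det (- rot e1 pi ** h) = - 1" if "h \<in> cyc e3 n" for h
    using that by (auto simp: cyc_def det_mul det_uminus_3 det_rot)
  with assms(2,3) show ?thesis
    unfolding Dz_elements[OF assms(1)] by auto
qed

lemma clip_axial:
  assumes "n \<ge> 1"
  shows "Dz n \<inter> oplus_Z2c (cyc e3 m) = cyc e3 (gcd m n)"
proof (intro equalityI subsetI)
  fix x assume x: "x \<in> Dz n \<inter> oplus_Z2c (cyc e3 m)"
  have "- h \<notin> Dz n" if "h \<in> cyc e3 m" for h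
  proof
    assume "- h \<in> Dz n"
    then have "- e3 = e3"
      using Dz_fixes_e3[OF assms] that
      by (fastforce simp: cyc_def rot_fixes_axis uminus_matrix_vector)
    then show False by (simp add: vec_eq_iff axis_def split: if_splits)
  qed
  then have "x \<in> cyc e3 m"
    using x by (auto simp: oplus_Z2c_def)
  then obtain \<theta> where \<theta>: "x = rot e3 \<theta>" "\<theta> \<in> angles m"
    by (auto simp: cyc_def)
  have "\<theta> \<in> angles n"
    using Dz_det_1[OF assms, of x] x \<theta>(1) by (simp add: det_rot rot_in_cyc_iff)
  with \<theta> show "x \<in> cyc e3 (gcd m n)"
    unfolding cyc_def angles_gcd[symmetric] by blast
next
  fix x assume "x \<in> cyc e3 (gcd m n)"
  then have "x \<in> cyc e3 m" "x \<in> cyc e3 n"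
    unfolding cyc_def angles_gcd[symmetric] by auto
  then show "x \<in> Dz n \<inter> oplus_Z2c (cyc e3 m)"
    using cyc_subset_oplus_Z2c by (auto simp: Dz_elements[OF assms])
qed

text \<open>Here \<open>x\<close> is orthogonal with \<open>x e\<^sub>3 = e\<^sub>3\<close> and \<open>x a = \<plusminus>a\<close>, according to its determinant, so that
  \<open>O3_eqI\<close> identifies it.\<close>

lemma clip_oblique:
  assumes "n \<ge> 1" "norm a = 1" "a \<times> e3 \<noteq> 0"
    and x: "x \<in> Dz n" "x \<in> oplus_Z2c (cyc a m)"
  shows "x = mat 1 \<or> x = - rot a pi \<and> even m \<and> a \<bullet> e3 = 0"
proof -
  have xO: "x \<in> O3" and xe: "x *v e3 = e3"
    using Dz_subset_O3 Dz_fixes_e3 assms(1) x(1) by auto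
  consider \<theta> where "x = rot a \<theta>" | \<theta> where "x = - rot a \<theta>" "\<theta> \<in> angles m"
    using x(2) by (auto simp: oplus_Z2c_def cyc_def)
  then show ?thesis
  proof cases
    case 1
    have "x = mat 1"
      by (rule O3_eqI[OF xO O3_mat_1 _ _ _ assms(3)])
        (simp_all only: xe matrix_vector_mul_lid, simp_all add: 1 det_rot rot_fixes_axis assms(2))
    then show ?thesis ..
  next
    case 2
    have xa: "x *v a = - a"
      by (simp add: 2 uminus_matrix_vector rot_fixes_axis assms(2))
    have "a \<bullet> e3 = - (a \<bullet> e3)"
      using O3_inner[OF xO, of a e3] by (simp add: xa xe)
    then have perp: "a \<bullet> e3 = 0" by simp
    have "x = - rot a pi"
    proof (rule O3_eqI[OF xO O3_uminus[OF rot_O3] _ _ _ assms(3)])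
      show "det x = det (- rot a pi)"
        by (simp add: 2 det_uminus_3 det_rot assms(2))
      show "x *v a = (- rot a pi) *v a"
        by (simp add: xa uminus_matrix_vector rot_fixes_axis assms(2))
      show "x *v e3 = (- rot a pi) *v e3"
        by (simp only: xe uminus_matrix_vector) (simp add: rot_unit_apply assms(2) perp)
    qed (rule assms(2))
    moreover have "even m"
    proof -
      have "rot a pi = rot a \<theta>"
        using \<open>x = - rot a pi\<close> 2(1) by simp
      then have "rot a pi \<in> cyc a m"
        using 2(2) by (simp add: cyc_def)
      then show ?thesis
        by (simp add: rot_in_cyc_iff assms(2) pi_in_angles_iff)
    qed
    ultimately show ?thesis using perp by simp
  qed
qed

lemma mat_1_in_clip:
  assumes "n \<ge> 1"
  shows "mat 1 \<in> Dz n \<inter> oplus_Z2c (cyc a m)"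
  using mat_1_in_cyc by (auto simp: Dz_elements[OF assms] oplus_Z2c_def)

lemma clip_generic:
  assumes "n \<ge> 1" "norm a = 1" "a \<times> e3 \<noteq> 0" "a \<bullet> e3 \<noteq> 0"
  shows "Dz n \<inter> oplus_Z2c (cyc a m) = Triv"
  using clip_oblique[OF assms(1-3)] mat_1_in_clip[OF assms(1)] assms(4) by (auto simp: Triv_def)

lemma parallel_e3:
  fixes a :: "real^3"
  assumes "norm a = 1" "a \<times> e3 = 0"
  shows "a = e3 \<or> a = - e3"
proof -
  have a: "a $ 1 = 0" "a $ 2 = 0"
    using assms(2) by (simp_all add: cross3_def axis_def vec_eq_iff forall_3)
  then have "\<bar>a $ 3\<bar> = 1"
    using assms(1) by (simp add: norm_vec_def L2_set_def sum_3)
  then show ?thesis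
    using a by (auto simp: vec_eq_iff forall_3 axis_def abs_if split: if_splits)
qed

lemma conj_class_clip:
  assumes "n \<ge> 1" "norm a = 1"
  shows "conj_class (Dz n \<inter> oplus_Z2c (cyc a m)) \<in>
    {conj_class Triv, conj_class (cyc e3 (gcd m n))} \<union> (if even m then {conj_class Z2minus} else {})"
    (is "conj_class ?I \<in> _")
proof (cases "a \<times> e3 = 0")
  case True
  then have "cyc a m = cyc e3 m"
    using parallel_e3[OF assms(2)] cyc_uminus[of e3] by auto
  then show ?thesis by (simp add: clip_axial[OF assms(1)])
next
  case False
  then have "?I = Triv \<or> ?I = {mat 1, - rot a pi} \<and> even m"
    using clip_oblique[OF assms] mat_1_in_clip[OF assms(1)] unfolding Triv_def by blast
  then show ?thesis
    using conj_class_reflection[OF assms(2)] by auto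
qed

lemma clip_e1:
  assumes "n \<ge> 1" "even m"
  shows "Dz n \<inter> oplus_Z2c (cyc e1 m) = {mat 1, - rot e1 pi}"
proof -
  have "e1 \<times> e3 \<noteq> 0"
    by (simp add: cross3_def axis_def vec_eq_iff forall_3)
  moreover have "- rot e1 pi \<in> Dz n"
    unfolding Dz_elements[OF assms(1)] using mat_1_in_cyc by (force simp: image_iff)
  moreover have "- rot e1 pi \<in> oplus_Z2c (cyc e1 m)"
    using assms(2) by (simp add: oplus_Z2c_def rot_in_cyc_iff pi_in_angles_iff)
  ultimately show ?thesis
    using clip_oblique[OF assms(1), of e1] mat_1_in_clip[OF assms(1)] by auto
qed

text \<open>A conjugating matrix matters only through the axis \<open>a = g e\<^sub>3\<close>, and \<open>g e\<^sub>3\<close> runs over the whole unit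
  sphere.\<close>

lemma clips_by_axis:
  assumes "m \<ge> 1"
  shows "conj_class (Dz n) \<circledcirc> conj_class (oplus_Z2c (Zcyc m)) =
    {conj_class (Dz n \<inter> oplus_Z2c (cyc a m)) | a. norm a = 1}"
proof -
  have "conj_set g (oplus_Z2c (Zcyc m)) = oplus_Z2c (cyc (g *v e3) m)" if "g \<in> O3" for g
    using that assms by (simp add: conj_set_oplus_Z2c Zcyc_eq_cyc conj_set_cyc)
  moreover have "norm a = 1 \<longleftrightarrow> (\<exists>g\<in>O3. a = g *v e3)" for a
    using O3_moves_e3[of a] by (auto simp: O3_norm)
  ultimately show ?thesis
    unfolding clips_conj_class by (auto; metis)
qed

theorem lemma4p7:
  fixes m n d :: nat
  assumes "m \<ge> 2" and "n \<ge> 2" and "d = gcd m n"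
  shows "conj_class (Dz n) \<circledcirc> conj_class (oplus_Z2c (Zcyc m)) =
    (if odd m then {conj_class Triv, conj_class (Zcyc d)}
     else {conj_class Triv, conj_class Z2minus, conj_class (Zcyc d)})"
proof -
  have n: "n \<ge> 1" and m: "m \<ge> 1" using assms by auto
  have d: "Zcyc d = cyc e3 (gcd m n)"
    using assms by (simp add: Zcyc_eq_cyc Suc_le_eq)
  let ?C = "{conj_class (Dz n \<inter> oplus_Z2c (cyc a m)) | a. norm a = 1}"
  have "conj_class (Zcyc d) \<in> ?C"
    unfolding d clip_axial[OF n, symmetric] using norm_axis_1 by blast
  moreover have "conj_class Triv \<in> ?C"
  proof -
    \<comment> \<open>A unit vector neither parallel nor orthogonal to \<open>e\<^sub>3\<close>, with rational coordinates.\<close>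
    define a :: "real^3" where "a = vector [3/5, 0, 4/5]"
    have a: "norm a = 1" "a \<times> e3 \<noteq> 0" "a \<bullet> e3 \<noteq> 0"
      by (simp_all add: a_def norm_vec_def L2_set_def sum_3 cross3_def axis_def vec_eq_iff
          forall_3 inner_vec_def power2_eq_square)
    then show ?thesis
      using clip_generic[OF n a] by (metis (mono_tags, lifting) mem_Collect_eq)
  qed
  moreover have "conj_class Z2minus \<in> ?C" if "even m"
  proof -
    have "norm e1 = 1" by simp
    then show ?thesis
      using clip_e1[OF n that] conj_class_reflection[of e1]
      by (metis (mono_tags, lifting) mem_Collect_eq)
  qed
  moreover have "?C \<subseteq> {conj_class Triv, conj_class (Zcyc d)} \<union>
      (if even m then {conj_class Z2minus} else {})"
    using conj_class_clip[OF n] unfolding d by blast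
  ultimately have "?C = {conj_class Triv, conj_class (Zcyc d)} \<union>
      (if even m then {conj_class Z2minus} else {})"
    by auto
  then show ?thesis
    unfolding clips_by_axis[OF m] by auto
qed

end
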